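(* Assume that $\delta^\star:=\min_{1\le i,j\le K}Q_\star(i,j)>0$ and that $\pi^\star$ is the stationary distribution of $Q_\star$. Then for all $k\ge 1$ and all $y_{1:k}=(y_1,\dots,y_k)\in\mathcal Y^k$, $$\|\phi^\star_k(\cdot,y_{1:k})-\widehat\phi_k(\cdot,y_{1:k})\|_{\mathrm{tv}}\le C_\star\Big(\rho_\star^{k-1}\|\pi^\star-\widehat\pi\|_2/\delta^\star+\|Q_\star-\widehat Q\|_F/(\delta^\star(1-\rho_\star))+\sum_{\ell=1}^k\rho_\star^{k-\ell}c_\star^{-1}(y_\ell)\max_{x\in\mathcal X}|f^\star_x(y_\ell)-\widehat f_x(y_\ell)|\Big),$$ where $\rho_\star:=1-\delta^\star/(1-\delta^\star)$ and $C_\star:=4(1-\delta^\star)/\delta^\star$.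
   Context: Setting. $K\ge2$ is an integer, $\mathcal X=\{1,\dots,K\}$, $\mathcal Y\subset\mathbb R^D$. $Q_\star$ is a $K\times K$ transition matrix, $\pi^\star$ a probability vector on $\mathcal X$, and for $x\in\mathcal X$, $f^\star_x:\mathcal Y\to[0,\infty)$ is a probability density with respect to Lebesgue measure on $\mathcal Y$; these are the parameters of a hidden Markov model. $\widehat\pi$, $\widehat Q$, $(\widehat f_x)_{x\in\mathcal X}$ are estimators of them: a probability vector, a transition matrix and nonnegative functions on $\mathcal Y$. For $y\in\mathcal Y$, $c_\star(y):=\min_{x\in\mathcal X}\sum_{x'\in\mathcal X}Q_\star(x,x')f^\star_{x'}(y)$. The filtering distributions are given recursively by $$\phi^\star_1(x,y_1)=\frac{\pi^\star(x)f^\star_x(y_1)}{\sum_{x'}\pi^\star(x')f^\star_{x'}(y_1)},\qquad \phi^\star_k(x,y_{1:k})=\frac{\sum_{x'}Q_\star(x',x)f^\star_x(y_k)\phi^\star_{k-1}(x',y_{1:k-1})}{\sum_{x',x''}Q_\star(x',x'')f^\star_{x''}(y_k)\phi^\star_{k-1}(x',y_{1:k-1})},$$ and $\widehat\phi_k$ is obtained by the same recursion with $\pi^\star,Q_\star,f^\star$ replaced by $\widehat\pi,\widehat Q,\widehat f$. It is understood that the denominators in these recursions are positive (and if $c_\star(y_\ell)=0$ for some $\ell$ the right-hand side of the bound is $+\infty$). $\|\mu-\nu\|_{\mathrm{tv}}=\sum_{x\in\mathcal X}|\mu(x)-\nu(x)|$ is the total variation norm, $\|\cdot\|_2$ the Euclidean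 norm, $\|\cdot\|_F$ the Frobenius norm. *)

theory Defs
  imports "HOL-Analysis.Analysis"
begin

text \<open>The state space \<open>{1, \<dots>, K}\<close> is rendered by a finite index type \<open>'k\<close> with \<open>CARD('k) = K\<close>;
  probability vectors on it are elements of \<open>real ^ 'k\<close>, transition matrices elements of
  \<open>real ^ 'k ^ 'k\<close>, with \<open>Q $ x $ x'\<close> the probability of moving from \<open>x\<close> to \<open>x'\<close>.
  Observation sequences are 1-indexed.\<close>

definition prob_vector :: "real ^ 'k \<Rightarrow> bool" where
  "prob_vector p \<longleftrightarrow> (\<forall>x. 0 \<le> p $ x) \<and> (\<Sum>x\<in>UNIV. p $ x) = 1"

definition transition_matrix :: "real ^ 'k ^ 'k \<Rightarrow> bool" where
  "transition_matrix Q \<longleftrightarrow> (\<forall>x. prob_vector (Q $ x))"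

definition stationary_distribution :: "real ^ 'k ^ 'k \<Rightarrow> real ^ 'k \<Rightarrow> bool" where
  "stationary_distribution Q p \<longleftrightarrow> prob_vector p \<and> p v* Q = p"

definition lebesgue_prob_density_on :: "(real ^ 'd) set \<Rightarrow> (real ^ 'd \<Rightarrow> real) \<Rightarrow> bool" where
  "lebesgue_prob_density_on Y g \<longleftrightarrow>
     (\<forall>y\<in>Y. 0 \<le> g y) \<and> g \<in> borel_measurable (lebesgue_on Y) \<and>
     (\<integral>\<^sup>+ y. ennreal (g y) \<partial>lebesgue_on Y) = 1"

text \<open>There is no filtering distribution at time 0: \<open>filtering p Q f y 0\<close> is unspecified.\<close>

fun filtering ::
  "real ^ 'k \<Rightarrow> real ^ 'k ^ 'k \<Rightarrow> ('k \<Rightarrow> 'y \<Rightarrow> real) \<Rightarrow> (nat \<Rightarrow> 'y) \<Rightarrow> nat \<Rightarrow> real ^ 'k" where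
  "filtering p Q f y (Suc 0) =
     (\<chi> x. p $ x * f x (y 1) / (\<Sum>x'\<in>UNIV. p $ x' * f x' (y 1)))"
| "filtering p Q f y (Suc (Suc k)) =
     (\<chi> x. (\<Sum>x'\<in>UNIV. Q $ x' $ x * f x (y (Suc (Suc k))) * filtering p Q f y (Suc k) $ x') /
           (\<Sum>x'\<in>UNIV. \<Sum>x''\<in>UNIV.
              Q $ x' $ x'' * f x'' (y (Suc (Suc k))) * filtering p Q f y (Suc k) $ x'))"

definition filtering_denominator ::
  "real ^ 'k \<Rightarrow> real ^ 'k ^ 'k \<Rightarrow> ('k \<Rightarrow> 'y \<Rightarrow> real) \<Rightarrow> (nat \<Rightarrow> 'y) \<Rightarrow> nat \<Rightarrow> real" where
  "filtering_denominator p Q f y k =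
     (if k = 1 then (\<Sum>x'\<in>UNIV. p $ x' * f x' (y 1))
      else (\<Sum>x'\<in>UNIV. \<Sum>x''\<in>UNIV. Q $ x' $ x'' * f x'' (y k) * filtering p Q f y (k - 1) $ x'))"

definition tv_norm :: "real ^ 'k \<Rightarrow> real" where
  "tv_norm v = (\<Sum>x\<in>UNIV. \<bar>v $ x\<bar>)"

definition frobenius_norm :: "real ^ 'k ^ 'k \<Rightarrow> real" where
  "frobenius_norm A = sqrt (\<Sum>i\<in>UNIV. \<Sum>j\<in>UNIV. (A $ i $ j)\<^sup>2)"

lemma frobenius_norm_eq_norm: "frobenius_norm A = norm A"
  by (simp add: frobenius_norm_def norm_vec_def L2_set_def sum_nonneg)

definition min_entry :: "real ^ 'k ^ 'k \<Rightarrow> real" where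
  "min_entry Q = Min (range (\<lambda>(i, j). Q $ i $ j))"

definition rho_star :: "real ^ 'k ^ 'k \<Rightarrow> real" where
  "rho_star Q = 1 - min_entry Q / (1 - min_entry Q)"

definition C_star :: "real ^ 'k ^ 'k \<Rightarrow> real" where
  "C_star Q = 4 * (1 - min_entry Q) / min_entry Q"

text \<open>If all entries of \<open>Q\<close> and all denominators of the filtering recursion along \<open>y\<close> are positive,
  then \<open>c_star Q f (y l) > 0\<close>, because \<open>c_star Q f z\<close> is at least \<open>min_entry Q\<close> times the sum of the
  \<open>f x z\<close>. Hence the inverse of \<open>c_star\<close> is never taken at zero in the bound, and no
  extended real numbers are needed.\<close>

definition c_star :: "real ^ 'k ^ 'k \<Rightarrow> ('k \<Rightarrow> 'y \<Rightarrow> real) \<Rightarrow> 'y \<Rightarrow> real" where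
  "c_star Q f z = Min (range (\<lambda>x. \<Sum>x'\<in>UNIV. Q $ x $ x' * f x' z))"

end

theory Submission
  imports Defs
begin

text \<open>
  Replace the true filter by the estimated one, one time step at a time.  Exchanging them at time
  \<open>l\<close> costs a local error, which the true filter then forgets geometrically over the remaining
  \<open>k - l\<close> steps.  For the forgetting, the composition of the last \<open>n\<close> true filtering steps, which is
  not linear, is factored as a Bayes update by the backward function \<open>\<beta>\<close> (the likelihood of the
  remaining observations as a function of the current state) followed by a linear product of \<open>n\<close>
  Markov kernels.  Since the entries of \<open>Q\<close> lie in \<open>[\<delta>, 1 - \<delta>]\<close>, each of these kernels satisfies a
  Doeblin condition with constant \<open>\<delta> / (1 - \<delta>)\<close>, hence contracts by \<open>\<rho>\<close>, and \<open>\<beta>\<close> varies by a factor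
  at most \<open>(1 - \<delta>) / \<delta>\<close>.
\<close>

section \<open>Bayes updates and the total variation norm\<close>

text \<open>Bayes' rule with prior \<open>p\<close> and likelihood \<open>g\<close>. One filtering
  step is the prediction \<open>p v* Q\<close> followed by this update.\<close>

definition reweight :: "('k \<Rightarrow> real) \<Rightarrow> real ^ 'k \<Rightarrow> real ^ 'k" where
  "reweight g p = (\<chi> x. p $ x * g x / (\<Sum>x'\<in>UNIV. p $ x' * g x'))"

lemma prob_vector_nonneg: "prob_vector p \<Longrightarrow> 0 \<le> p $ x"
  by (simp add: prob_vector_def)

lemma prob_vector_sum: "prob_vector p \<Longrightarrow> (\<Sum>x\<in>UNIV. p $ x) = 1"
  by (simp add: prob_vector_def)

lemma transition_matrix_nonneg: "transition_matrix Q \<Longrightarrow> 0 \<le> Q $ i $ j"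
  by (simp add: transition_matrix_def prob_vector_def)

lemma transition_matrix_row_sum: "transition_matrix Q \<Longrightarrow> (\<Sum>j\<in>UNIV. Q $ i $ j) = 1"
  by (simp add: transition_matrix_def prob_vector_def)

lemma vector_matrix_mult_component:
  fixes v :: "real ^ 'n" and A :: "real ^ 'm ^ 'n"
  shows "(v v* A) $ j = (\<Sum>i\<in>UNIV. v $ i * A $ i $ j)"
  by (simp add: vector_matrix_mult_def mult.commute)

lemma sum_vector_matrix_mult_weighted:
  fixes v :: "real ^ 'n" and A :: "real ^ 'm ^ 'n"
  shows "(\<Sum>j\<in>UNIV. (v v* A) $ j * h j) = (\<Sum>i\<in>UNIV. v $ i * (\<Sum>j\<in>UNIV. A $ i $ j * h j))"
  by (simp add: vector_matrix_mult_component sum_distrib_right sum_distrib_left mult.assoc)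
     (rule sum.swap)

lemma sum_vector_transition_matrix:
  assumes "transition_matrix Q"
  shows "(\<Sum>j\<in>UNIV. (v v* Q) $ j) = (\<Sum>i\<in>UNIV. v $ i)"
  using sum_vector_matrix_mult_weighted[of v Q "\<lambda>_. 1"] assms
  by (simp add: transition_matrix_row_sum)

lemma prob_vector_vector_transition_matrix:
  assumes "prob_vector p" "transition_matrix Q"
  shows "prob_vector (p v* Q)"
  unfolding prob_vector_def
  using assms sum_vector_transition_matrix[OF assms(2), of p]
  by (auto simp: vector_matrix_mult_component prob_vector_sum
        intro!: sum_nonneg mult_nonneg_nonneg prob_vector_nonneg transition_matrix_nonneg)

lemma prob_vector_reweight:
  assumes "\<And>x. 0 \<le> p $ x * g x" "0 < (\<Sum>x\<in>UNIV. p $ x * g x)"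
  shows "prob_vector (reweight g p)"
  unfolding prob_vector_def reweight_def
  using assms by (auto simp flip: sum_divide_distrib intro: divide_nonneg_pos)

lemma prob_vector_weighted_sum_ge:
  assumes "prob_vector p" "\<And>x. c \<le> g x"
  shows "c \<le> (\<Sum>x\<in>UNIV. p $ x * g x)"
proof -
  have "c = (\<Sum>x\<in>UNIV. p $ x * c)"
    using prob_vector_sum[OF assms(1)] by (simp flip: sum_distrib_right)
  also have "\<dots> \<le> (\<Sum>x\<in>UNIV. p $ x * g x)"
    by (intro sum_mono mult_left_mono assms prob_vector_nonneg)
  finally show ?thesis .
qed

lemma prob_vector_weighted_sum_le:
  assumes "prob_vector p" "\<And>x. g x \<le> c"
  shows "(\<Sum>x\<in>UNIV. p $ x * g x) \<le> c"
  using prob_vector_weighted_sum_ge[OF assms(1), of "- c" "\<lambda>x. - g x"] assms(2)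
  by (simp add: sum_negf)

lemma tv_norm_triangle: "tv_norm (u - w) \<le> tv_norm (u - v) + tv_norm (v - w)"
  unfolding tv_norm_def sum.distrib[symmetric] by (rule sum_mono) simp

text \<open>Changing the numerators costs at most D / a, where D is the l1 distance of the
  unnormalised vectors and a the normaliser of the first one. Changing the normaliser costs |b - a|
  / a, again at most D / a; hence the factor 2. Only the first normaliser survives, which matters
  because later it is the one with a lower bound.\<close>

lemma tv_norm_reweight_diff_le:
  assumes pos: "0 < (\<Sum>x\<in>UNIV. p $ x * g x)" "0 < (\<Sum>x\<in>UNIV. q $ x * h x)"
    and nonneg: "\<And>x. 0 \<le> q $ x * h x"
  shows "tv_norm (reweight g p - reweight h q)
    \<le> 2 * (\<Sum>x\<in>UNIV. \<bar>p $ x * g x - q $ x * h x\<bar>) / (\<Sum>x\<in>UNIV. p $ x * g x)"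
proof -
  define a where "a = (\<Sum>x\<in>UNIV. p $ x * g x)"
  define b where "b = (\<Sum>x\<in>UNIV. q $ x * h x)"
  define D where "D = (\<Sum>x\<in>UNIV. \<bar>p $ x * g x - q $ x * h x\<bar>)"
  have a: "0 < a" and b: "0 < b" using pos by (simp_all add: a_def b_def)
  have "\<bar>b - a\<bar> \<le> D"
    unfolding a_def b_def D_def sum_subtractf[symmetric]
    by (subst abs_minus_commute, rule order_trans[OF _ sum_abs]) (simp flip: sum_subtractf)
  have "\<bar>p $ x * g x / a - q $ x * h x / b\<bar>
      \<le> \<bar>p $ x * g x - q $ x * h x\<bar> / a + q $ x * h x * (\<bar>b - a\<bar> / (a * b))" for x
  proof -
    have "p $ x * g x / a - q $ x * h x / b
        = (p $ x * g x - q $ x * h x) / a + q $ x * h x * ((b - a) / (a * b))"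
      using a b by (simp add: field_simps)
    also have "\<bar>\<dots>\<bar> \<le> \<bar>p $ x * g x - q $ x * h x\<bar> / a + \<bar>q $ x * h x\<bar> * (\<bar>b - a\<bar> / (a * b))"
      using a b by (intro order_trans[OF abs_triangle_ineq]) (simp add: abs_mult)
    finally show ?thesis using nonneg[of x] by simp
  qed
  then have "tv_norm (reweight g p - reweight h q)
      \<le> (\<Sum>x\<in>UNIV. \<bar>p $ x * g x - q $ x * h x\<bar> / a + q $ x * h x * (\<bar>b - a\<bar> / (a * b)))"
    unfolding tv_norm_def reweight_def a_def[symmetric] b_def[symmetric]
    by (intro sum_mono) simp
  also have "\<dots> = D / a + b * (\<bar>b - a\<bar> / (a * b))"
    unfolding sum.distrib sum_divide_distrib[symmetric] sum_distrib_right[symmetric]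
    by (simp add: D_def b_def)
  also have "\<dots> = (D + \<bar>b - a\<bar>) / a"
    using a b by (simp add: field_simps)
  also have "\<dots> \<le> 2 * D / a"
    using a \<open>\<bar>b - a\<bar> \<le> D\<close> by (intro divide_right_mono) auto
  finally show ?thesis by (simp add: a_def D_def)
qed

text \<open>As \<open>v\<close> has total mass 0, subtracting the part
  \<open>\<epsilon> * \<eta> j\<close>, which does not depend on the row, leaves
  \<open>v v* F\<close> unchanged. What remains of \<open>F\<close> is nonnegative with row sums
  \<open>1 - \<epsilon>\<close>.\<close>

lemma tv_norm_Doeblin_contraction:
  fixes v :: "real ^ 'k" and F :: "real ^ 'k ^ 'k"
  assumes F: "transition_matrix F"
    and minor: "\<And>i j. \<epsilon> * \<eta> j \<le> F $ i $ j"
    and \<eta>: "(\<Sum>j\<in>UNIV. \<eta> j) = 1"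
    and v: "(\<Sum>i\<in>UNIV. v $ i) = 0"
  shows "tv_norm (v v* F) \<le> (1 - \<epsilon>) * tv_norm v"
proof -
  have "\<bar>(v v* F) $ j\<bar> \<le> (\<Sum>i\<in>UNIV. \<bar>v $ i\<bar> * (F $ i $ j - \<epsilon> * \<eta> j))" for j
  proof -
    have "(v v* F) $ j = (\<Sum>i\<in>UNIV. v $ i * (F $ i $ j - \<epsilon> * \<eta> j))"
      using v by (simp add: vector_matrix_mult_component right_diff_distrib sum_subtractf
          flip: sum_distrib_right)
    also have "\<bar>\<dots>\<bar> \<le> (\<Sum>i\<in>UNIV. \<bar>v $ i * (F $ i $ j - \<epsilon> * \<eta> j)\<bar>)"
      by (rule sum_abs)
    finally show ?thesis using minor[of j] by (simp add: abs_mult)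
  qed
  then have "tv_norm (v v* F) \<le> (\<Sum>j\<in>UNIV. \<Sum>i\<in>UNIV. \<bar>v $ i\<bar> * (F $ i $ j - \<epsilon> * \<eta> j))"
    unfolding tv_norm_def by (rule sum_mono)
  also have "\<dots> = (\<Sum>i\<in>UNIV. \<bar>v $ i\<bar> * (1 - \<epsilon>))"
    by (subst sum.swap)
       (simp add: sum_subtractf transition_matrix_row_sum[OF F] \<eta> flip: sum_distrib_left)
  finally show ?thesis
    by (simp add: tv_norm_def sum_distrib_left mult.commute)
qed

section \<open>Forgetting of the initial distribution\<close>

text \<open>\<open>\<beta>\<close> and \<open>R\<close> depend on the observations but not on
  \<open>p\<close>, so two filters run on the same observations can be compared through a linear
  map. The induction adds the earliest observation last, which is the direction of the backward
  recursion.\<close>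

lemma filter_steps_factorization:
  fixes Q :: "real ^ 'k ^ 'k"
  assumes Q: "transition_matrix Q"
    and bounds: "\<And>i j. \<delta> \<le> Q $ i $ j" "\<And>i j. Q $ i $ j \<le> \<kappa>" and \<delta>: "0 < \<delta>"
    and gs: "\<forall>g\<in>set gs. \<forall>x. 0 \<le> g x" "\<forall>g\<in>set gs. \<exists>x. 0 < g x"
  shows "\<exists>\<beta> R. (\<forall>x. 0 < \<beta> x) \<and> (\<forall>x x'. \<delta> / \<kappa> * \<beta> x' \<le> \<beta> x) \<and>
    (\<forall>v. (\<Sum>x\<in>UNIV. v $ x) = 0 \<longrightarrow> tv_norm (v v* R) \<le> (1 - \<delta> / \<kappa>) ^ length gs * tv_norm v) \<and>
    (\<forall>p. prob_vector p \<longrightarrow> fold (\<lambda>g p. reweight g (p v* Q)) gs p = reweight \<beta> p v* R)"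
  using gs
proof (induction gs)
  case Nil
  \<comment> \<open>With no observation left the likelihood is the constant 1, whose ratio bound
    amounts to \<open>\<delta> \<le> \<kappa>\<close>.\<close>
  have "\<delta> \<le> \<kappa>" using bounds order_trans by blast
  then show ?case
    using \<delta>
    by (intro exI[of _ "\<lambda>_. 1"] exI[of _ "mat 1"])
       (auto simp: reweight_def prob_vector_def vec_eq_iff)
next
  case (Cons g gs)
  then obtain \<beta> R where \<beta>: "\<And>x. 0 < \<beta> x"
    and R: "\<And>v. (\<Sum>x\<in>UNIV. v $ x) = 0 \<Longrightarrow>
        tv_norm (v v* R) \<le> (1 - \<delta> / \<kappa>) ^ length gs * tv_norm v"
    and fold: "\<And>p. prob_vector p \<Longrightarrow> fold (\<lambda>g p. reweight g (p v* Q)) gs p = reweight \<beta> p v* R"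
    by force
  have \<kappa>: "0 < \<kappa>" using \<delta> bounds order_trans less_le_trans by metis
  have \<epsilon>: "\<delta> / \<kappa> \<le> 1"
    using \<kappa> bounds order_trans by (metis divide_le_eq_1_pos)
  \<comment> \<open>\<open>\<beta>'\<close> is the backward recursion. \<open>F\<close> is the Doob
    transform of \<open>Q\<close> by \<open>w\<close>: the law of the next state given the current
    one and all remaining observations.\<close>
  define w where "w x = g x * \<beta> x" for x
  define W where "W = (\<Sum>x\<in>UNIV. w x)"
  define \<beta>' where "\<beta>' x = (\<Sum>x'\<in>UNIV. Q $ x $ x' * w x')" for x
  define F where "F = (\<chi> x x'. Q $ x $ x' * w x' / \<beta>' x)"
  have g: "\<And>x. 0 \<le> g x" "\<exists>x. 0 < g x" using Cons.prems by auto
  have w: "0 \<le> w x" for x using g \<beta>[of x] by (simp add: w_def)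
  have W: "0 < W"
    unfolding W_def using g w \<beta> by (metis UNIV_I finite mult_pos_pos sum_pos2 w_def)
  \<comment> \<open>Each \<open>\<beta>' x\<close> averages the same \<open>w\<close> with one row
    of \<open>Q\<close>, so all its values lie between \<open>\<delta> * W\<close> and
    \<open>\<kappa> * W\<close>, whatever the observations are. This yields both the ratio bound and
    the Doeblin constant.\<close>
  have lower: "\<delta> * W \<le> \<beta>' x" and upper: "\<beta>' x \<le> \<kappa> * W" for x
    unfolding \<beta>'_def W_def sum_distrib_left
    by (intro sum_mono mult_right_mono bounds w)+
  have \<beta>': "0 < \<beta>' x" for x
    using lower[of x] W \<delta> by (meson less_le_trans mult_pos_pos)
  have ratio: "\<delta> / \<kappa> * \<beta>' x' \<le> \<beta>' x" for x x'
  proof -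
    have "\<delta> / \<kappa> * \<beta>' x' \<le> \<delta> / \<kappa> * (\<kappa> * W)"
      using \<delta> \<kappa> upper by (intro mult_left_mono) auto
    also have "\<dots> = \<delta> * W" using \<kappa> by simp
    finally show ?thesis using lower[of x] by simp
  qed
  have F: "transition_matrix F"
    using w \<beta>' transition_matrix_nonneg[OF Q]
    by (auto simp: F_def transition_matrix_def prob_vector_def less_imp_le less_imp_neq[symmetric]
        simp flip: sum_divide_distrib \<beta>'_def)
  \<comment> \<open>The minorising distribution \<open>w / W\<close> does not depend on the starting
    state: the numerator of \<open>F\<close> uses \<open>Q\<close> from below, the denominator uses
    \<open>upper\<close>.\<close>
  have minor: "\<delta> / \<kappa> * (w x' / W) \<le> F $ x $ x'" for x x'
  proof -
    have "\<delta> / \<kappa> * (w x' / W) = \<delta> * w x' / (\<kappa> * W)" by simp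
    also have "\<dots> \<le> Q $ x $ x' * w x' / \<beta>' x"
      using \<delta> w bounds(1) upper \<beta>'
      by (intro frac_le mult_right_mono mult_nonneg_nonneg transition_matrix_nonneg[OF Q]) auto
    finally show ?thesis by (simp add: F_def)
  qed
  have contr: "tv_norm (v v* (F ** R)) \<le> (1 - \<delta> / \<kappa>) ^ length (g # gs) * tv_norm v"
    if v: "(\<Sum>x\<in>UNIV. v $ x) = 0" for v
  proof -
    have "tv_norm (v v* (F ** R)) = tv_norm ((v v* F) v* R)"
      by (simp add: vector_matrix_mul_assoc)
    also have "\<dots> \<le> (1 - \<delta> / \<kappa>) ^ length gs * tv_norm (v v* F)"
      using v F by (intro R) (simp add: sum_vector_transition_matrix)
    also have "\<dots> \<le> (1 - \<delta> / \<kappa>) ^ length gs * ((1 - \<delta> / \<kappa>) * tv_norm v)"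
      using \<epsilon> W v
      by (intro mult_left_mono tv_norm_Doeblin_contraction[OF F minor])
         (simp_all add: W_def flip: sum_divide_distrib)
    finally show ?thesis by (simp add: mult_ac)
  qed
  have "fold (\<lambda>g p. reweight g (p v* Q)) (g # gs) p = reweight \<beta>' p v* (F ** R)"
    if p: "prob_vector p" for p
  proof -
    have pQ: "\<delta> \<le> (p v* Q) $ x" for x
      unfolding vector_matrix_mult_component by (intro prob_vector_weighted_sum_ge[OF p] bounds)
    have nonneg: "0 \<le> (p v* Q) $ x * g x" for x
      using g pQ[of x] \<delta> by simp
    \<comment> \<open>Prediction puts mass at least \<open>\<delta>\<close> on every state, so a
      single state with positive likelihood is enough.\<close>
    have pos: "0 < (\<Sum>x\<in>UNIV. (p v* Q) $ x * g x)"
    proof -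
      obtain x0 where "0 < g x0" using g(2) by blast
      then have "0 < (p v* Q) $ x0 * g x0" using pQ[of x0] \<delta> by simp
      then show ?thesis using nonneg by (intro sum_pos2[of UNIV x0]) auto
    qed
    define a where "a = (\<Sum>x\<in>UNIV. (p v* Q) $ x * g x)"
    have num: "(\<Sum>x\<in>UNIV. (p v* Q) $ x * w x) = (\<Sum>x\<in>UNIV. p $ x * \<beta>' x)"
      unfolding \<beta>'_def by (rule sum_vector_matrix_mult_weighted)
    \<comment> \<open>Both sides are the law of the next state given its own and all later
      observations. On the left it is updated in two stages, whose intermediate normaliser
      \<open>a\<close> cancels; on the right the current state is smoothed first and then moved by
      the conditioned kernel.\<close>
    have eq: "reweight \<beta> (reweight g (p v* Q)) = reweight \<beta>' p v* F"
    proof (subst vec_eq_iff, rule allI)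
      fix x
      have "reweight \<beta> (reweight g (p v* Q)) $ x
          = ((p v* Q) $ x * w x / a) / ((\<Sum>x\<in>UNIV. (p v* Q) $ x * w x) / a)"
        unfolding sum_divide_distrib by (simp add: reweight_def w_def a_def mult_ac)
      also have "\<dots> = (p v* Q) $ x * w x / (\<Sum>x\<in>UNIV. p $ x * \<beta>' x)"
        using pos by (simp add: num a_def)
      also have "\<dots> = (\<Sum>i\<in>UNIV. p $ i * (Q $ i $ x * w x)) / (\<Sum>x\<in>UNIV. p $ x * \<beta>' x)"
        by (simp add: vector_matrix_mult_component sum_distrib_right mult.assoc)
      also have "\<dots> = (\<Sum>i\<in>UNIV. (p $ i * \<beta>' i / (\<Sum>x\<in>UNIV. p $ x * \<beta>' x)) * F $ i $ x)"
        unfolding sum_divide_distrib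
        using \<beta>' by (intro sum.cong refl) (simp add: F_def less_imp_neq[symmetric])
      also have "\<dots> = (reweight \<beta>' p v* F) $ x"
        by (simp add: vector_matrix_mult_component reweight_def)
      finally show "reweight \<beta> (reweight g (p v* Q)) $ x = (reweight \<beta>' p v* F) $ x" .
    qed
    show ?thesis
      using fold[OF prob_vector_reweight[OF nonneg pos]]
      by (simp add: eq vector_matrix_mul_assoc)
  qed
  then show ?case
    using \<beta>' ratio contr by (intro exI[of _ \<beta>'] exI[of _ "F ** R"]) auto
qed

text \<open>The update by \<open>\<beta>\<close> is Lipschitz with constant
  \<open>2 * (\<kappa> / \<delta>)\<close> because \<open>\<beta>\<close> is nearly constant; this
  price is paid once, and \<open>R\<close> then contracts at every step.\<close>

lemma filter_steps_forgetting:
  fixes Q :: "real ^ 'k ^ 'k"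
  assumes Q: "transition_matrix Q"
    and bounds: "\<And>i j. \<delta> \<le> Q $ i $ j" "\<And>i j. Q $ i $ j \<le> \<kappa>" and \<delta>: "0 < \<delta>"
    and gs: "\<forall>g\<in>set gs. \<forall>x. 0 \<le> g x" "\<forall>g\<in>set gs. \<exists>x. 0 < g x"
    and p: "prob_vector p" and q: "prob_vector q"
  shows "tv_norm (fold (\<lambda>g p. reweight g (p v* Q)) gs p - fold (\<lambda>g p. reweight g (p v* Q)) gs q)
    \<le> 2 * (\<kappa> / \<delta>) * (1 - \<delta> / \<kappa>) ^ length gs * tv_norm (p - q)"
proof -
  obtain \<beta> R where \<beta>: "\<And>x. 0 < \<beta> x" and ratio: "\<And>x x'. \<delta> / \<kappa> * \<beta> x' \<le> \<beta> x"
    and R: "\<And>v. (\<Sum>x\<in>UNIV. v $ x) = 0 \<Longrightarrow>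
        tv_norm (v v* R) \<le> (1 - \<delta> / \<kappa>) ^ length gs * tv_norm v"
    and fold: "\<And>p. prob_vector p \<Longrightarrow> fold (\<lambda>g p. reweight g (p v* Q)) gs p = reweight \<beta> p v* R"
    using filter_steps_factorization[OF Q bounds \<delta> gs] by metis
  have \<kappa>: "0 < \<kappa>" using \<delta> bounds order_trans less_le_trans by metis
  have \<epsilon>: "\<delta> / \<kappa> \<le> 1"
    using \<kappa> bounds order_trans by (metis divide_le_eq_1_pos)
  have pos: "0 < (\<Sum>x\<in>UNIV. r $ x * \<beta> x)" if "prob_vector r" for r
  proof -
    have "0 < Min (range \<beta>)" using \<beta> by simp
    also have "\<dots> \<le> (\<Sum>x\<in>UNIV. r $ x * \<beta> x)"
      by (intro prob_vector_weighted_sum_ge[OF that]) simp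
    finally show ?thesis .
  qed
  have pr: "prob_vector (reweight \<beta> r)" if "prob_vector r" for r
    using pos[OF that] prob_vector_nonneg[OF that] \<beta>
    by (intro prob_vector_reweight) (auto simp: less_imp_le)
  define S where "S = (\<Sum>x\<in>UNIV. p $ x * \<beta> x)"
  have S: "0 < S" using pos[OF p] by (simp add: S_def)
  \<comment> \<open>Averaging the ratio bound against \<open>p\<close> compares
    \<open>\<beta>\<close> with its own normaliser, so \<open>S\<close> cancels below.\<close>
  have \<beta>S: "\<beta> x \<le> \<kappa> / \<delta> * S" for x
  proof -
    have "\<delta> / \<kappa> * \<beta> x \<le> S"
      unfolding S_def by (intro prob_vector_weighted_sum_ge[OF p] ratio)
    then show ?thesis using \<delta> \<kappa> by (simp add: field_simps)
  qed
  have "(\<Sum>x\<in>UNIV. \<bar>p $ x * \<beta> x - q $ x * \<beta> x\<bar>) \<le> (\<Sum>x\<in>UNIV. \<bar>(p - q) $ x\<bar> * (\<kappa> / \<delta> * S))"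
    unfolding left_diff_distrib[symmetric] abs_mult
    by (intro sum_mono mult_mono) (use less_imp_le[OF \<beta>] \<beta>S in simp_all)
  also have "\<dots> = \<kappa> / \<delta> * S * tv_norm (p - q)"
    unfolding sum_distrib_right[symmetric] by (simp add: tv_norm_def)
  finally have D: "(\<Sum>x\<in>UNIV. \<bar>p $ x * \<beta> x - q $ x * \<beta> x\<bar>) \<le> \<kappa> / \<delta> * S * tv_norm (p - q)" .
  have "tv_norm (reweight \<beta> p - reweight \<beta> q)
      \<le> 2 * (\<Sum>x\<in>UNIV. \<bar>p $ x * \<beta> x - q $ x * \<beta> x\<bar>) / S"
    unfolding S_def using prob_vector_nonneg[OF q] \<beta>
    by (intro tv_norm_reweight_diff_le pos p q) (auto simp: less_imp_le)
  also have "\<dots> \<le> 2 * (\<kappa> / \<delta> * S * tv_norm (p - q)) / S"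
    using D S by (intro divide_right_mono) auto
  also have "\<dots> = 2 * (\<kappa> / \<delta>) * tv_norm (p - q)" using S by simp
  finally have init: "tv_norm (reweight \<beta> p - reweight \<beta> q) \<le> 2 * (\<kappa> / \<delta>) * tv_norm (p - q)" .
  have "tv_norm ((reweight \<beta> p - reweight \<beta> q) v* R)
      \<le> (1 - \<delta> / \<kappa>) ^ length gs * tv_norm (reweight \<beta> p - reweight \<beta> q)"
    using prob_vector_sum[OF pr[OF p]] prob_vector_sum[OF pr[OF q]]
    by (intro R) (simp add: sum_subtractf)
  also have "\<dots> \<le> (1 - \<delta> / \<kappa>) ^ length gs * (2 * (\<kappa> / \<delta>) * tv_norm (p - q))"
    using \<epsilon> by (intro mult_left_mono init) simp
  finally show ?thesis
    by (simp add: fold[OF p] fold[OF q] vector_matrix_mult_diff_distrib mult_ac)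
qed

section \<open>The error of a single step\<close>

text \<open>Split the difference of \<open>p * g\<close> and \<open>q * h\<close> into
  \<open>(p - q) * g\<close> and \<open>q * (g - h)\<close>. Since \<open>p\<close> is at least
  \<open>\<delta>\<close>, the first part is at most \<open>d / \<delta>\<close> times
  \<open>p * g\<close>, and division by the normaliser removes \<open>g\<close> altogether. The
  second sums to at most \<open>e\<close>, as \<open>q\<close> has mass 1. Measuring
  \<open>p - q\<close> by its largest entry avoids any factor depending on the number of
  states.\<close>

lemma tv_norm_reweight_perturbation:
  assumes p: "\<And>x. \<delta> \<le> p $ x" and \<delta>: "0 < \<delta>"
    and q: "prob_vector q"
    and g: "\<And>x. 0 \<le> g x" and h: "\<And>x. 0 \<le> h x"
    and c: "0 < c" "c \<le> (\<Sum>x\<in>UNIV. p $ x * g x)"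
    and pos: "0 < (\<Sum>x\<in>UNIV. q $ x * h x)"
    and d: "\<And>x. \<bar>p $ x - q $ x\<bar> \<le> d" and e: "\<And>x. \<bar>g x - h x\<bar> \<le> e"
  shows "tv_norm (reweight g p - reweight h q) \<le> 2 * (d / \<delta> + inverse c * e)"
proof -
  define S where "S = (\<Sum>x\<in>UNIV. p $ x * g x)"
  have S: "0 < S" "c \<le> S" using c by (auto simp: S_def)
  have "0 \<le> d" "0 \<le> e" using d e abs_ge_zero order_trans by blast+
  have "\<bar>p $ x * g x - q $ x * h x\<bar> \<le> d / \<delta> * (p $ x * g x) + q $ x * e" for x
  proof -
    have "\<bar>p $ x * g x - q $ x * h x\<bar> = \<bar>(p $ x - q $ x) * g x + q $ x * (g x - h x)\<bar>"
      by (simp add: algebra_simps)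
    also have "\<dots> \<le> \<bar>p $ x - q $ x\<bar> * g x + q $ x * \<bar>g x - h x\<bar>"
      using g[of x] prob_vector_nonneg[OF q, of x]
      by (intro order_trans[OF abs_triangle_ineq]) (simp add: abs_mult)
    also have "\<dots> \<le> d * g x + q $ x * e"
      using g d e prob_vector_nonneg[OF q] by (intro add_mono mult_right_mono mult_left_mono) auto
    also have "d * g x \<le> d / \<delta> * (p $ x * g x)"
      using mult_left_mono[OF mult_right_mono[OF p[of x] g[of x]] \<open>0 \<le> d\<close>] \<delta>
      by (simp add: field_simps)
    finally show ?thesis by (simp add: mult_ac)
  qed
  then have "(\<Sum>x\<in>UNIV. \<bar>p $ x * g x - q $ x * h x\<bar>)
      \<le> (\<Sum>x\<in>UNIV. d / \<delta> * (p $ x * g x) + q $ x * e)"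
    by (rule sum_mono)
  also have "\<dots> = d / \<delta> * S + e"
    unfolding sum.distrib S_def sum_distrib_left[symmetric] sum_distrib_right[symmetric]
    using prob_vector_sum[OF q] by simp
  finally have D: "(\<Sum>x\<in>UNIV. \<bar>p $ x * g x - q $ x * h x\<bar>) \<le> d / \<delta> * S + e" .
  have "tv_norm (reweight g p - reweight h q)
      \<le> 2 * (\<Sum>x\<in>UNIV. \<bar>p $ x * g x - q $ x * h x\<bar>) / S"
    unfolding S_def using S pos h prob_vector_nonneg[OF q]
    by (intro tv_norm_reweight_diff_le) (auto simp: S_def)
  also have "\<dots> \<le> 2 * (d / \<delta> * S + e) / S"
    using D S by (intro divide_right_mono) auto
  also have "\<dots> = 2 * (d / \<delta> + e / S)" using S by (simp add: field_simps)
  also have "\<dots> \<le> 2 * (d / \<delta> + e / c)"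
    using S c \<open>0 \<le> e\<close> by (intro mult_left_mono add_left_mono divide_left_mono) auto
  finally show ?thesis by (simp add: divide_inverse mult.commute)
qed

section \<open>The filtering recursion as prediction and update\<close>

lemma filtering_Suc_0: "filtering p Q f y (Suc 0) = reweight (\<lambda>x. f x (y 1)) p"
  by (simp add: reweight_def)

lemma filtering_Suc_Suc:
  "filtering p Q f y (Suc (Suc n))
    = reweight (\<lambda>x. f x (y (Suc (Suc n)))) (filtering p Q f y (Suc n) v* Q)"
  unfolding filtering.simps reweight_def sum_vector_matrix_mult_weighted
  by (simp add: vec_eq_iff vector_matrix_mult_component sum_distrib_left sum_distrib_right mult_ac)

lemma filtering_denominator_1:
  "filtering_denominator p Q f y (Suc 0) = (\<Sum>x\<in>UNIV. p $ x * f x (y 1))"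
  by (simp add: filtering_denominator_def)

lemma filtering_denominator_Suc_Suc:
  "filtering_denominator p Q f y (Suc (Suc n))
    = (\<Sum>x\<in>UNIV. (filtering p Q f y (Suc n) v* Q) $ x * f x (y (Suc (Suc n))))"
  unfolding filtering_denominator_def sum_vector_matrix_mult_weighted
  by (simp add: sum_distrib_left mult_ac)

lemma prob_vector_filtering:
  assumes p: "prob_vector p" and Q: "transition_matrix Q"
    and f: "\<And>l x. l \<in> {1..k} \<Longrightarrow> 0 \<le> f x (y l)"
    and pos: "\<And>l. l \<in> {1..k} \<Longrightarrow> 0 < filtering_denominator p Q f y l"
    and n: "n \<in> {1..k}"
  shows "prob_vector (filtering p Q f y n)"
proof -
  have "1 \<le> n" using n by simp
  then show ?thesis
    using n
  proof (induction n rule: dec_induct)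
    case base
    then show ?case
      using pos[of 1] f[of 1] prob_vector_nonneg[OF p]
      by (auto simp: filtering_Suc_0 filtering_denominator_1 simp del: filtering.simps
          intro!: prob_vector_reweight)
  next
    case (step n)
    then obtain m where m: "n = Suc m" by (cases n) auto
    have pred: "prob_vector (filtering p Q f y (Suc m) v* Q)"
      using step m by (intro prob_vector_vector_transition_matrix Q) simp
    then show ?case
      unfolding m filtering_Suc_Suc
      using pos[of "Suc n"] f[of "Suc n"] step.prems prob_vector_nonneg[OF pred]
      by (auto simp: m filtering_denominator_Suc_Suc simp del: filtering.simps
          intro!: prob_vector_reweight)
  qed
qed

text \<open>Observation 1 enters through the initial filter, so reaching time \<open>n + 1\<close>
  takes the \<open>n\<close> observations with indices 2 to \<open>n + 1\<close>.\<close>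

lemma filtering_eq_fold:
  "filtering p Q f y (Suc n)
    = fold (\<lambda>g p. reweight g (p v* Q)) (map (\<lambda>l x. f x (y l)) [2..<n + 2]) (filtering p Q f y (Suc 0))"
proof (induction n)
  case (Suc n)
  then show ?case by (simp add: filtering_Suc_Suc del: filtering.simps)
qed simp

lemma stationary_distribution_eq:
  assumes "stationary_distribution Q p"
  shows "p v* Q = p"
  using assms by (simp add: stationary_distribution_def)

text \<open>The normaliser of a true step started from \<open>p\<close> is a
  \<open>p\<close>-average of the quantities whose minimum is \<open>c_star\<close>. This is how the
  inverse of \<open>c_star\<close> enters the bound.\<close>

lemma c_star_le:
  assumes "prob_vector p"
  shows "c_star Q f z \<le> (\<Sum>x\<in>UNIV. (p v* Q) $ x * f x z)"
  unfolding sum_vector_matrix_mult_weighted c_star_def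
  by (intro prob_vector_weighted_sum_ge[OF assms]) simp

lemma c_star_pos:
  assumes "\<And>i j. 0 < Q $ i $ j" "\<And>x. 0 \<le> f x z" "0 < f x0 z"
  shows "0 < c_star Q f z"
  unfolding c_star_def using assms
  by (auto intro!: sum_pos2[of UNIV x0] simp: less_imp_le)

lemma exists_pos_if_filtering_denominator_pos:
  assumes "0 < filtering_denominator p Q f y l" "\<And>x. 0 \<le> f x (y l)"
  shows "\<exists>x. 0 < f x (y l)"
proof (rule ccontr)
  assume "\<nexists>x. 0 < f x (y l)"
  then have "f x (y l) = 0" for x using assms(2)[of x] by (meson antisym not_le)
  then have "filtering_denominator p Q f y l = 0"
    by (cases "l = 1") (simp_all add: filtering_denominator_def)
  with assms(1) show False by simp
qed

section \<open>Summing the propagated local errors\<close>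

theorem proposition2p1:
  fixes Y :: "(real ^ 'd) set"
    and Qs Qh :: "real ^ 'k ^ 'k"
    and pis pih :: "real ^ 'k"
    and fs fh :: "'k \<Rightarrow> real ^ 'd \<Rightarrow> real"
    and y :: "nat \<Rightarrow> real ^ 'd"
    and k :: nat
  assumes "CARD('k) \<ge> 2"
    and "transition_matrix Qs"
    and "\<And>x. lebesgue_prob_density_on Y (fs x)"
    and "transition_matrix Qh"
    and "prob_vector pih"
    and "\<And>x z. z \<in> Y \<Longrightarrow> 0 \<le> fh x z"
    and "min_entry Qs > 0"
    and "stationary_distribution Qs pis"
    and "k \<ge> 1"
    and "\<And>l. l \<in> {1..k} \<Longrightarrow> y l \<in> Y"
    and "\<And>l. l \<in> {1..k} \<Longrightarrow> filtering_denominator pis Qs fs y l > 0"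
    and "\<And>l. l \<in> {1..k} \<Longrightarrow> filtering_denominator pih Qh fh y l > 0"
  shows "tv_norm (filtering pis Qs fs y k - filtering pih Qh fh y k)
    \<le> C_star Qs *
       (rho_star Qs ^ (k - 1) * norm (pis - pih) / min_entry Qs
        + frobenius_norm (Qs - Qh) / (min_entry Qs * (1 - rho_star Qs))
        + (\<Sum>l = 1..k. rho_star Qs ^ (k - l) * inverse (c_star Qs fs (y l))
             * Max (range (\<lambda>x. \<bar>fs x (y l) - fh x (y l)\<bar>))))"
proof -
  define \<delta> where "\<delta> = min_entry Qs"
  define \<kappa> where "\<kappa> = 1 - \<delta>"
  define \<rho> where "\<rho> = rho_star Qs"
  have \<delta>: "0 < \<delta>" using assms(7) by (simp add: \<delta>_def)
  have lower: "\<delta> \<le> Qs $ i $ j" for i j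
    unfolding \<delta>_def min_entry_def by (rule Min_le) (auto intro!: image_eqI[of _ _ "(i, j)"])
  \<comment> \<open>Since there are at least two states, another entry of the same row takes at
    least \<open>\<delta>\<close> of the total mass 1.\<close>
  have upper: "Qs $ i $ j \<le> \<kappa>" for i j
  proof -
    have "\<exists>j'. j' \<noteq> j"
    proof (rule ccontr)
      assume "\<nexists>j'. j' \<noteq> j"
      then have "(UNIV :: 'k set) = {j}" by auto
      then have "CARD('k) = 1" by (metis card_1_singleton_iff One_nat_def)
      with assms(1) show False by simp
    qed
    then obtain j' where "j' \<noteq> j" by blast
    then have "Qs $ i $ j + Qs $ i $ j' = (\<Sum>x\<in>{j, j'}. Qs $ i $ x)" by simp
    also have "\<dots> \<le> (\<Sum>x\<in>UNIV. Qs $ i $ x)"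
      by (intro sum_mono2) (auto intro: transition_matrix_nonneg[OF assms(2)])
    also have "\<dots> = 1" by (rule transition_matrix_row_sum[OF assms(2)])
    finally show ?thesis using lower[of i j'] by (simp add: \<kappa>_def)
  qed
  have "\<delta> \<le> \<kappa>" using lower upper order_trans by blast
  then have \<kappa>: "0 < \<kappa>" using \<delta> by simp
  have \<rho>: "\<rho> = 1 - \<delta> / \<kappa>" by (simp add: \<rho>_def rho_star_def \<delta>_def \<kappa>_def)
  have \<rho>_bounds: "0 \<le> \<rho>" "\<rho> < 1"
    using \<open>\<delta> \<le> \<kappa>\<close> \<delta> \<kappa> by (auto simp: \<rho>)
  have pis: "prob_vector pis" using assms(8) by (simp add: stationary_distribution_def)
  \<comment> \<open>Stationarity makes \<open>pis\<close> itself a predicted distribution, so time 1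
    enjoys the same lower bounds by \<open>\<delta>\<close> and \<open>c_star\<close> as later
    times.\<close>
  have pis_eq: "pis v* Qs = pis" by (rule stationary_distribution_eq[OF assms(8)])
  have pred_lower: "\<delta> \<le> (p v* Qs) $ x" if "prob_vector p" for p x
    unfolding vector_matrix_mult_component by (intro prob_vector_weighted_sum_ge[OF that] lower)
  define g where "g l x = fs x (y l)" for l x
  define h where "h l x = fh x (y l)" for l x
  define c where "c l = c_star Qs fs (y l)" for l
  define e where "e l = Max (range (\<lambda>x. \<bar>fs x (y l) - fh x (y l)\<bar>))" for l
  have g: "0 \<le> g l x" and h: "0 \<le> h l x" if "l \<in> {1..k}" for l x
    using assms(3)[of x] assms(6,10) that by (auto simp: g_def h_def lebesgue_prob_density_on_def)
  have g_pos: "\<exists>x. 0 < g l x" if "l \<in> {1..k}" for l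
    unfolding g_def using that g[OF that]
    by (intro exists_pos_if_filtering_denominator_pos[OF assms(11)]) (auto simp: g_def)
  have c: "0 < c l" if l: "l \<in> {1..k}" for l
  proof -
    obtain x0 where "0 < g l x0" using g_pos[OF l] by blast
    then show ?thesis
      unfolding c_def using \<delta> lower g[OF l]
      by (intro c_star_pos[where ?x0.0 = x0]) (auto simp: g_def intro: less_le_trans)
  qed
  have c_le: "c l \<le> (\<Sum>x\<in>UNIV. (p v* Qs) $ x * g l x)" if "prob_vector p" for p l
    unfolding c_def g_def by (rule c_star_le[OF that])
  have e: "\<bar>g l x - h l x\<bar> \<le> e l" for l x
    unfolding e_def g_def h_def by (rule Max_ge) auto
  define \<phi> where "\<phi> n = filtering pih Qh fh y n" for n
  have \<phi>: "prob_vector (\<phi> n)" if "n \<in> {1..k}" for n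
    unfolding \<phi>_def using h
    by (intro prob_vector_filtering[OF assms(5,4) _ assms(12) that]) (auto simp: h_def)
  define A where "A = norm (pis - pih) / \<delta>"
  define B where "B = frobenius_norm (Qs - Qh) / \<delta>"
  have err1: "tv_norm (filtering pis Qs fs y (Suc 0) - \<phi> 1) \<le> 2 * (A + inverse (c 1) * e 1)"
  proof -
    have 1: "1 \<in> {1..k}" using assms(9) by simp
    have "tv_norm (reweight (g 1) pis - reweight (h 1) pih) \<le> 2 * (A + inverse (c 1) * e 1)"
      unfolding A_def
    proof (rule tv_norm_reweight_perturbation[OF _ \<delta> assms(5) g[OF 1] h[OF 1] c[OF 1] _ _ _ e])
      show "\<delta> \<le> pis $ x" for x using pred_lower[OF pis, of x] by (simp add: pis_eq)
      show "c 1 \<le> (\<Sum>x\<in>UNIV. pis $ x * g 1 x)" using c_le[OF pis, of 1] by (simp add: pis_eq)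
      show "0 < (\<Sum>x\<in>UNIV. pih $ x * h 1 x)"
        using assms(12)[OF 1] by (simp add: filtering_denominator_def h_def)
      show "\<bar>pis $ x - pih $ x\<bar> \<le> norm (pis - pih)" for x
        using component_le_norm_cart[of "pis - pih" x] by simp
    qed
    then show ?thesis
      by (simp add: \<phi>_def filtering_Suc_0 g_def[abs_def] h_def[abs_def] del: filtering.simps)
  qed
  \<comment> \<open>The local error at a later time: a true and an estimated step, both started from
    the estimated filter \<open>\<phi> l\<close>. The predictions differ by a
    \<open>\<phi> l\<close>-average of entries of \<open>Qs - Qh\<close>, each bounded by the
    Frobenius norm.\<close>
  have err: "tv_norm (reweight (g (Suc l)) (\<phi> l v* Qs) - \<phi> (Suc l))
      \<le> 2 * (B + inverse (c (Suc l)) * e (Suc l))" if l: "1 \<le> l" "Suc l \<le> k" for l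
  proof -
    have l': "l \<in> {1..k}" "Suc l \<in> {1..k}" using l by auto
    obtain m where m: "l = Suc m" using l by (cases l) auto
    note p = \<phi>[OF l'(1)]
    have "tv_norm (reweight (g (Suc l)) (\<phi> l v* Qs) - reweight (h (Suc l)) (\<phi> l v* Qh))
        \<le> 2 * (B + inverse (c (Suc l)) * e (Suc l))"
      unfolding B_def
    proof (rule tv_norm_reweight_perturbation[OF pred_lower[OF p] \<delta>
          prob_vector_vector_transition_matrix[OF p assms(4)]
          g[OF l'(2)] h[OF l'(2)] c[OF l'(2)] c_le[OF p] _ _ e])
      show "0 < (\<Sum>x\<in>UNIV. (\<phi> l v* Qh) $ x * h (Suc l) x)"
        using assms(12)[OF l'(2)] by (simp add: m \<phi>_def filtering_denominator_Suc_Suc h_def)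
      show "\<bar>(\<phi> l v* Qs) $ x - (\<phi> l v* Qh) $ x\<bar> \<le> frobenius_norm (Qs - Qh)" for x
      proof -
        have entry: "\<bar>Qs $ i $ x - Qh $ i $ x\<bar> \<le> frobenius_norm (Qs - Qh)" for i
        proof -
          have "\<bar>(Qs - Qh) $ i $ x\<bar> \<le> norm ((Qs - Qh) $ i)" by (rule component_le_norm_cart)
          also have "\<dots> \<le> norm (Qs - Qh)" by (rule Finite_Cartesian_Product.norm_nth_le)
          finally show ?thesis by (simp add: frobenius_norm_eq_norm)
        qed
        have "(\<phi> l v* Qs) $ x - (\<phi> l v* Qh) $ x = (\<Sum>i\<in>UNIV. \<phi> l $ i * (Qs $ i $ x - Qh $ i $ x))"
          by (simp add: vector_matrix_mult_component right_diff_distrib sum_subtractf)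
        also have "\<bar>\<dots>\<bar> \<le> (\<Sum>i\<in>UNIV. \<phi> l $ i * \<bar>Qs $ i $ x - Qh $ i $ x\<bar>)"
          using prob_vector_nonneg[OF p]
          by (intro order_trans[OF sum_abs]) (simp add: abs_mult)
        also have "\<dots> \<le> frobenius_norm (Qs - Qh)"
          by (intro prob_vector_weighted_sum_le[OF p] entry)
        finally show ?thesis .
      qed
    qed
    then show ?thesis
      by (simp add: m \<phi>_def filtering_Suc_Suc h_def[abs_def] del: filtering.simps)
  qed
  \<comment> \<open>The hybrid filter: estimated up to time \<open>l\<close>, then true steps with
    the \<open>k - l\<close> observations from \<open>l + 1\<close> to \<open>k\<close>. At
    \<open>l = k\<close> it is the estimated filter.\<close>
  define T where
    "T l = fold (\<lambda>g p. reweight g (p v* Qs)) (map g [Suc l..<Suc k]) (\<phi> l)" for l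
  define C where "C = 2 * (\<kappa> / \<delta>)"
  have "0 \<le> C" using \<kappa> \<delta> by (simp add: C_def)
  have forget: "tv_norm (fold (\<lambda>g p. reweight g (p v* Qs)) (map g [Suc l..<Suc k]) p
        - fold (\<lambda>g p. reweight g (p v* Qs)) (map g [Suc l..<Suc k]) q)
      \<le> C * \<rho> ^ (k - l) * b"
    if "prob_vector p" "prob_vector q" "tv_norm (p - q) \<le> b" for p q l b
  proof -
    have "tv_norm (fold (\<lambda>g p. reweight g (p v* Qs)) (map g [Suc l..<Suc k]) p
        - fold (\<lambda>g p. reweight g (p v* Qs)) (map g [Suc l..<Suc k]) q)
      \<le> 2 * (\<kappa> / \<delta>) * (1 - \<delta> / \<kappa>) ^ length (map g [Suc l..<Suc k]) * tv_norm (p - q)"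
      using g g_pos that
      by (intro filter_steps_forgetting[OF assms(2) lower upper \<delta>]) auto
    also have "\<dots> = C * \<rho> ^ (k - l) * tv_norm (p - q)"
      by (simp add: C_def \<rho> del: upt_Suc)
    also have "\<dots> \<le> C * \<rho> ^ (k - l) * b"
      using \<open>0 \<le> C\<close> \<rho>_bounds that by (intro mult_left_mono) auto
    finally show ?thesis .
  qed
  \<comment> \<open>The initial law contributes only at time 1 and the transition matrix only from
    time 2 on. The factor \<open>2 * C\<close> combines the 2 of the local errors with the
    forgetting constant \<open>C\<close>.\<close>
  have telescope: "tv_norm (filtering pis Qs fs y k - T n)
      \<le> 2 * C * (\<rho> ^ (k - 1) * A + (\<Sum>l = 2..n. \<rho> ^ (k - l) * B)
          + (\<Sum>l = 1..n. \<rho> ^ (k - l) * (inverse (c l) * e l)))"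
    if "1 \<le> n" "n \<le> k" for n
    using that
  proof (induction n rule: dec_induct)
    case base
    have "filtering pis Qs fs y k
        = fold (\<lambda>g p. reweight g (p v* Qs)) (map g [Suc 1..<Suc k]) (filtering pis Qs fs y (Suc 0))"
      using filtering_eq_fold[of pis Qs fs y "k - 1"] assms(9)
      by (simp add: g_def[abs_def] numeral_2_eq_2 del: filtering.simps upt_Suc)
    moreover have "prob_vector (filtering pis Qs fs y (Suc 0))"
      using assms(9) g
      by (intro prob_vector_filtering[OF pis assms(2) _ assms(11)]) (auto simp: g_def)
    moreover have "prob_vector (\<phi> 1)" using assms(9) by (intro \<phi>) simp
    ultimately show ?case
      using forget[OF _ _ err1, of 1] by (simp add: T_def algebra_simps del: filtering.simps upt_Suc)
  next
    case (step n)
    have n: "n \<in> {1..k}" "Suc n \<in> {1..k}" using step by auto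
    \<comment> \<open>Peeling off the true step at time \<open>n + 1\<close> shows
      \<open>T n\<close> and \<open>T (Suc n)\<close> as the same composition of later steps,
      started from two points whose distance is bounded by \<open>err\<close>.\<close>
    have "T n = fold (\<lambda>g p. reweight g (p v* Qs)) (map g [Suc (Suc n)..<Suc k])
        (reweight (g (Suc n)) (\<phi> n v* Qs))"
      unfolding T_def using step.prems by (subst upt_conv_Cons) (simp_all del: upt_Suc)
    moreover have "prob_vector (reweight (g (Suc n)) (\<phi> n v* Qs))"
    proof (rule prob_vector_reweight)
      show "0 \<le> (\<phi> n v* Qs) $ x * g (Suc n) x" for x
        using pred_lower[OF \<phi>[OF n(1)], of x] g[OF n(2), of x] \<delta> by simp
      show "0 < (\<Sum>x\<in>UNIV. (\<phi> n v* Qs) $ x * g (Suc n) x)"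
        using c_le[OF \<phi>[OF n(1)]] c[OF n(2)] by (rule less_le_trans[rotated])
    qed
    ultimately have "tv_norm (T n - T (Suc n))
        \<le> C * \<rho> ^ (k - Suc n) * (2 * (B + inverse (c (Suc n)) * e (Suc n)))"
      using forget[OF _ \<phi>[OF n(2)] err[OF step.hyps(1) step.prems], of "Suc n"]
      by (simp add: T_def del: upt_Suc)
    then show ?case
      using step.IH step.prems step.hyps
        tv_norm_triangle[of "filtering pis Qs fs y k" "T (Suc n)" "T n"]
      by (simp add: algebra_simps)
  qed
  have "0 \<le> B" using \<delta> by (simp add: B_def frobenius_norm_eq_norm)
  have geom: "(\<Sum>l = 2..k. \<rho> ^ (k - l)) \<le> 1 / (1 - \<rho>)"
  proof -
    \<comment> \<open>The exponent \<open>k - l\<close> runs over 0 to \<open>k - 2\<close>; for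
      \<open>k = 1\<close> both sums are empty.\<close>
    have "(\<Sum>l = 2..k. \<rho> ^ (k - l)) = (\<Sum>i\<in>{..<k - 1}. \<rho> ^ i)"
      by (rule sum.reindex_bij_witness[of _ "\<lambda>i. k - i" "\<lambda>l. k - l"]) auto
    also have "\<dots> = (1 - \<rho> ^ (k - 1)) / (1 - \<rho>)"
      using \<rho>_bounds by (simp add: sum_gp_strict)
    also have "\<dots> \<le> 1 / (1 - \<rho>)"
      using \<rho>_bounds by (intro divide_right_mono) auto
    finally show ?thesis .
  qed
  have "(\<Sum>l = 2..k. \<rho> ^ (k - l) * B) \<le> 1 / (1 - \<rho>) * B"
    unfolding sum_distrib_right[symmetric] by (intro mult_right_mono geom \<open>0 \<le> B\<close>)
  then have "tv_norm (filtering pis Qs fs y k - T k)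
      \<le> 2 * C * (\<rho> ^ (k - 1) * A + 1 / (1 - \<rho>) * B
          + (\<Sum>l = 1..k. \<rho> ^ (k - l) * (inverse (c l) * e l)))"
    using \<open>0 \<le> C\<close>
    by (intro order_trans[OF telescope[OF assms(9) order_refl]] mult_left_mono
        add_right_mono add_left_mono) simp_all
  moreover have "T k = filtering pih Qh fh y k" by (simp add: T_def \<phi>_def)
  moreover have "C_star Qs = 2 * C" by (simp add: C_star_def C_def \<kappa>_def \<delta>_def)
  ultimately show ?thesis
    by (simp add: A_def B_def c_def e_def \<rho>_def[symmetric] \<delta>_def[symmetric] mult_ac)
qed

end
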